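(* The $\mathbb{F}$-algebra $U_q(\mathfrak{sl}_2)$ has a presentation by generators $\nu_x$, $y^{\pm 1}$, $\nu_z$ and relations $$y y^{-1} = y^{-1} y = 1,\qquad y \nu_x y^{-1} = q^{-2} \nu_x,\qquad y \nu_z y^{-1} = q^2 \nu_z,$$ $$\frac{q\nu_z \nu_x - q^{-1} \nu_x \nu_z}{q-q^{-1}} = 1-y^2.$$ An isomorphism from this presentation to the Chevalley presentation (generators $e,f,k^{\pm1}$) sends $$\nu_x \mapsto -q(q-q^{-1})kf,\qquad y^{\pm 1} \mapsto k^{\pm 1},\qquad \nu_z \mapsto (q-q^{-1})e.$$ The inverse isomorphism sends $$e \mapsto (q-q^{-1})^{-1}\nu_z,\qquad k^{\pm 1} \mapsto y^{\pm 1},\qquad f \mapsto -q^{-1}(q-q^{-1})^{-1}y^{-1}\nu_x.$$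
   Context: Algebras are associative with $1$. $\mathbb{F}$ is a field and $q\in\mathbb{F}$ is nonzero with $q^4\neq 1$. The Chevalley presentation: $U_q(\mathfrak{sl}_2)$ is the $\mathbb{F}$-algebra with generators $e,f,k^{\pm1}$ and relations $kk^{-1}=k^{-1}k=1$, $kek^{-1}=q^2e$, $kfk^{-1}=q^{-2}f$, $ef-fe=\frac{k-k^{-1}}{q-q^{-1}}$. The equitable presentation: $U_q(\mathfrak{sl}_2)$ also has a presentation by generators $x,y^{\pm1},z$ and relations $yy^{-1}=y^{-1}y=1$, $\frac{qxy-q^{-1}yx}{q-q^{-1}}=\frac{qyz-q^{-1}zy}{q-q^{-1}}=\frac{qzx-q^{-1}xz}{q-q^{-1}}=1$; the two are identified via $x=k^{-1}-k^{-1}eq(q-q^{-1})$, $y^{\pm1}=k^{\pm1}$, $z=k^{-1}+f(q-q^{-1})$. The elements $\nu_x,\nu_z$ of $U_q(\mathfrak{sl}_2)$ are $$\nu_x=q(1-yz)=q^{-1}(1-zy),\qquad \nu_z=q(1-xy)=q^{-1}(1-yx).$$ *)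

theory Defs
  imports "HOL-Algebra.Algebraic_Closure_Type" "HOL-Library.Poly_Mapping"
begin

section \<open>Free associative algebras\<close>

text \<open>
  The free monoid on \<open>'g\<close>, written additively so that \<open>'g free_monoid \<Rightarrow>\<^sub>0 'a\<close>
  carries the convolution product of \<^theory>\<open>HOL-Library.Poly_Mapping\<close>; the addition is
  concatenation and is not commutative.
\<close>

datatype 'g free_monoid = Word "'g list"

instantiation free_monoid :: (type) monoid_add
begin

definition zero_free_monoid :: "'g free_monoid"
  where "zero_free_monoid = Word []"

fun plus_free_monoid :: "'g free_monoid \<Rightarrow> 'g free_monoid \<Rightarrow> 'g free_monoid"
  where "plus_free_monoid (Word u) (Word v) = Word (u @ v)"

instance
proof
  fix a b c :: "'g free_monoid"
  show "a + b + c = a + (b + c)" by (cases a; cases b; cases c) simp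
  show "0 + a = a" by (cases a) (simp add: zero_free_monoid_def)
  show "a + 0 = a" by (cases a) (simp add: zero_free_monoid_def)
qed

end

type_synonym ('g, 'a) free_algebra = "'g free_monoid \<Rightarrow>\<^sub>0 'a"

definition gvar :: "'g \<Rightarrow> ('g, 'a::field) free_algebra"
  where "gvar g = Poly_Mapping.single (Word [g]) 1"

definition const :: "'a::field \<Rightarrow> ('g, 'a) free_algebra"
  where "const c = Poly_Mapping.single 0 c"

definition scale :: "'a::field \<Rightarrow> ('g, 'a) free_algebra \<Rightarrow> ('g, 'a) free_algebra"
    (infixr \<open>*\<^sub>s\<close> 75)
  where "c *\<^sub>s p = const c * p"


section \<open>Algebras given by generators and relations\<close>

text \<open>
  A set of pairs \<open>(l, r)\<close> of elements of the free algebra stands for the relations \<open>l = r\<close>.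
  The presented algebra is a \<^type>\<open>module\<close> record, that is, a ring record together
  with a scalar multiplication by the field \<^typ>\<open>'a\<close>.
\<close>

definition rel_ideal :: "(('g, 'a::field) free_algebra \<times> ('g, 'a) free_algebra) set
    \<Rightarrow> ('g, 'a) free_algebra set"
  where "rel_ideal rels = Idl\<^bsub>ring_of_type_algebra\<^esub> {l - r | l r. (l, r) \<in> rels}"

definition cls :: "(('g, 'a::field) free_algebra \<times> ('g, 'a) free_algebra) set
    \<Rightarrow> ('g, 'a) free_algebra \<Rightarrow> ('g, 'a) free_algebra set"
  where "cls rels p = rel_ideal rels +>\<^bsub>ring_of_type_algebra\<^esub> p"

definition presented_algebra :: "(('g, 'a::field) free_algebra \<times> ('g, 'a) free_algebra) set
    \<Rightarrow> ('a, ('g, 'a) free_algebra set) module"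
  where "presented_algebra rels =
    (let Q = ring_of_type_algebra Quot rel_ideal rels
     in ring.extend Q (module.fields (\<lambda>c A. cls rels (const c) \<otimes>\<^bsub>Q\<^esub> A)))"

definition alg_iso :: "('a, 'b) module \<Rightarrow> ('a, 'c) module \<Rightarrow> ('b \<Rightarrow> 'c) set"
  where "alg_iso A B =
    {h \<in> ring_iso A B. \<forall>c. \<forall>x \<in> carrier A. h (c \<odot>\<^bsub>A\<^esub> x) = c \<odot>\<^bsub>B\<^esub> h x}"

text \<open>
  The algebra \<open>A\<close> has a presentation by the generators \<open>gen g\<close>, where \<open>g\<close>
  runs over the type \<^typ>\<open>'g\<close>, and the relations \<open>rels\<close>.
\<close>

definition has_presentation :: "('a::field, 'b) module \<Rightarrow> ('g \<Rightarrow> 'b)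
    \<Rightarrow> (('g, 'a) free_algebra \<times> ('g, 'a) free_algebra) set \<Rightarrow> bool"
  where "has_presentation A gen rels \<longleftrightarrow>
    (\<exists>h \<in> alg_iso (presented_algebra rels) A. \<forall>g. h (cls rels (gvar g)) = gen g)"

lemma ring_ring_of_type_algebra: "ring (ring_of_type_algebra :: 'a::ring_1 ring)"
proof -
  have "\<exists>y. x + y = 0" for x :: 'a
    using add.right_inverse by blast
  thus ?thesis
    unfolding ring_of_type_algebra_def using add.right_inverse
    by unfold_locales (auto simp: algebra_simps Units_def)
qed

lemma ideal_rel_ideal: "ideal (rel_ideal rels) ring_of_type_algebra"
  unfolding rel_ideal_def
  by (rule ring.genideal_ideal[OF ring_ring_of_type_algebra]) (simp add: ring_of_type_algebra_def)

lemma presented_algebra_carrier: "carrier (presented_algebra rels) = range (cls rels)"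
  by (auto simp: presented_algebra_def Let_def ring.defs module.defs FactRing_def A_RCOSETS_def'
      cls_def a_r_coset_def' ring_of_type_algebra_def)

lemma presented_algebra_one: "\<one>\<^bsub>presented_algebra rels\<^esub> = cls rels 1"
  by (simp add: presented_algebra_def Let_def ring.defs module.defs FactRing_def cls_def
      ring_of_type_algebra_def)

lemma presented_algebra_mult:
  "cls rels p \<otimes>\<^bsub>presented_algebra rels\<^esub> cls rels r = cls rels (p * r)"
  using ideal.rcoset_mult_add[OF ideal_rel_ideal[of rels], of p r]
  by (simp add: presented_algebra_def Let_def ring.defs module.defs FactRing_def cls_def
      ring_of_type_algebra_def)

lemma presented_algebra_add:
  "cls rels p \<oplus>\<^bsub>presented_algebra rels\<^esub> cls rels r = cls rels (p + r)"
  using ideal.a_rcos_sum[OF ideal_rel_ideal[of rels], of p r]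
  by (simp add: presented_algebra_def Let_def ring.defs module.defs FactRing_def cls_def
      ring_of_type_algebra_def)

lemma presented_algebra_smult:
  "c \<odot>\<^bsub>presented_algebra rels\<^esub> cls rels p = cls rels (c *\<^sub>s p)"
  using ideal.rcoset_mult_add[OF ideal_rel_ideal[of rels], of "const c" p]
  by (simp add: presented_algebra_def Let_def ring.defs module.defs FactRing_def cls_def
      ring_of_type_algebra_def scale_def)


section \<open>The algebra \<open>U\<^sub>q(sl\<^sub>2)\<close>\<close>

text \<open>The inverse of an invertible generator is a generator of its own.\<close>

datatype chev_gen = E | F | K | Kinv

definition chev_rels :: "'a::field \<Rightarrow> ((chev_gen, 'a) free_algebra \<times> (chev_gen, 'a) free_algebra) set"
  where "chev_rels q =
    (let e = gvar E; f = gvar F; k = gvar K; k' = gvar Kinv in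
     {(k * k', 1),
      (k' * k, 1),
      (k * e * k', q\<^sup>2 *\<^sub>s e),
      (k * f * k', inverse (q\<^sup>2) *\<^sub>s f),
      (e * f - f * e, inverse (q - inverse q) *\<^sub>s (k - k'))})"

definition Uq :: "'a::field \<Rightarrow> ('a, (chev_gen, 'a) free_algebra set) module"
  where "Uq q = presented_algebra (chev_rels q)"

text \<open>
  The equitable generators \<open>x\<close>, \<open>y\<close>, \<open>z\<close>, as expressions in the Chevalley generators;
  the inverse of \<open>y\<close> is \<open>gvar Kinv\<close>.
\<close>

definition equit_x :: "'a::field \<Rightarrow> (chev_gen, 'a) free_algebra"
  where "equit_x q = gvar Kinv - (q * (q - inverse q)) *\<^sub>s (gvar Kinv * gvar E)"

definition equit_y :: "(chev_gen, 'a::field) free_algebra"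
  where "equit_y = gvar K"

definition equit_z :: "'a::field \<Rightarrow> (chev_gen, 'a) free_algebra"
  where "equit_z q = gvar Kinv + (q - inverse q) *\<^sub>s gvar F"

datatype nu_gen = NuX | Y | Yinv | NuZ

fun nu_elem :: "'a::field \<Rightarrow> nu_gen \<Rightarrow> (chev_gen, 'a) free_algebra set"
  where
    "nu_elem q NuX = cls (chev_rels q) (q *\<^sub>s (1 - equit_y * equit_z q))"
  | "nu_elem q Y = cls (chev_rels q) equit_y"
  | "nu_elem q Yinv = cls (chev_rels q) (gvar Kinv)"
  | "nu_elem q NuZ = cls (chev_rels q) (q *\<^sub>s (1 - equit_x q * equit_y))"

definition nu_rels :: "'a::field \<Rightarrow> ((nu_gen, 'a) free_algebra \<times> (nu_gen, 'a) free_algebra) set"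
  where "nu_rels q =
    (let nx = gvar NuX; y = gvar Y; y' = gvar Yinv; nz = gvar NuZ in
     {(y * y', 1),
      (y' * y, 1),
      (y * nx * y', inverse (q\<^sup>2) *\<^sub>s nx),
      (y * nz * y', q\<^sup>2 *\<^sub>s nz),
      (inverse (q - inverse q) *\<^sub>s (q *\<^sub>s (nz * nx) - inverse q *\<^sub>s (nx * nz)), 1 - y\<^sup>2)})"

end

theory Submission
  imports Defs
begin

text \<open>
  Substituting for the generators is compatible with the relations in both directions, and the two
  substitutions undo each other on generators modulo the relations, so they induce mutually inverse
  isomorphisms. Moreover \<open>\<nu>\<^sub>x = q(1 - yz)\<close> and \<open>\<nu>\<^sub>z = q(1 - xy)\<close> expand to
  \<open>-q(q - q\<^sup>-\<^sup>1)kf\<close> and \<open>(q - q\<^sup>-\<^sup>1)e\<close>, and moving \<open>k\<close> to the left turns the q-commutator of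
  \<open>\<nu>\<^sub>z\<close> and \<open>\<nu>\<^sub>x\<close> into a multiple of \<open>k(ef - fe)\<close>.
\<close>

section \<open>Scalars and induction in free algebras\<close>

lemma const_0 [simp]: "const 0 = 0"
  by (simp add: const_def)

lemma const_1 [simp]: "const 1 = 1"
  by (simp add: const_def)

lemma const_add: "const (c + d) = const c + const d"
  by (simp add: const_def single_add)

lemma const_mult: "const (c * d) = const c * const d"
  by (simp add: const_def mult_single)

lemma const_times_single:
  fixes c :: "'a::field"
  shows "const c * Poly_Mapping.single w d = Poly_Mapping.single w (c * d)"
  by (simp add: const_def mult_single)

text \<open>Updating a key outside the support amounts to adding a monomial, so every element is
  reached from monomials by addition.\<close>

lemma single_induct [case_names single add]:
  fixes p :: "'g \<Rightarrow>\<^sub>0 'a::comm_monoid_add"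
  assumes single: "\<And>w c. P (Poly_Mapping.single w c)"
    and add: "\<And>p r. P p \<Longrightarrow> P r \<Longrightarrow> P (p + r)"
  shows "P p"
proof (induction p rule: update_induct)
  case const
  \<comment> \<open>Zero is a monomial with coefficient 0, at an arbitrary key.\<close>
  show ?case using single[of undefined 0] by simp
next
  case (update f a b)
  have "Poly_Mapping.update a b f = f + Poly_Mapping.single a b"
    using update(1) by (intro poly_mapping_eqI)
      (auto simp: lookup_update lookup_add lookup_single when_def in_keys_iff)
  then show ?case using add[OF update(3) single] by simp
qed

lemma const_commute: "p * const c = const c * (p :: ('g, 'a::field) free_algebra)"
  by (induction p rule: single_induct)
    (simp_all add: const_def mult_single mult.commute distrib_left distrib_right)

text \<open>A monomial is a constant times a product of generators. This reduces identities modulo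
  relations to a check on generators.\<close>

lemma free_algebra_induct [case_names const gvar add mult]:
  fixes p :: "('g, 'a::field) free_algebra"
  assumes const: "\<And>c. P (const c)" and gvar: "\<And>g. P (gvar g)"
    and add: "\<And>p r. P p \<Longrightarrow> P r \<Longrightarrow> P (p + r)"
    and mult: "\<And>p r. P p \<Longrightarrow> P r \<Longrightarrow> P (p * r)"
  shows "P p"
proof (induction p rule: single_induct)
  case (single w c)
  have "P (Poly_Mapping.single (Word gs) 1)" for gs :: "'g list"
  proof (induction gs)
    case Nil
    show ?case using const[of 1] by (simp add: const_def zero_free_monoid_def)
  next
    case (Cons g gs)
    have "Poly_Mapping.single (Word (g # gs)) 1 = gvar g * Poly_Mapping.single (Word gs) (1::'a)"
      by (simp add: gvar_def mult_single)
    then show ?case using mult[OF gvar Cons] by simp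
  qed
  then have "P (const c * Poly_Mapping.single w 1)"
    by (cases w) (simp add: mult const)
  then show ?case by (simp add: const_times_single)
qed (rule add)

text \<open>With \<open>scale_mult_right\<close> and \<open>scale_scale\<close>, simplification
  collects all scalars in front of a product; what remains is arithmetic in the field.\<close>

lemma scale_mult_left [simp]: "(c *\<^sub>s p) * r = c *\<^sub>s (p * r)"
  by (simp add: scale_def mult.assoc)

lemma scale_mult_right [simp]: "p * (c *\<^sub>s r) = c *\<^sub>s (p * r)"
  by (metis scale_def mult.assoc const_commute)

lemma scale_scale [simp]: "c *\<^sub>s d *\<^sub>s p = (c * d) *\<^sub>s p"
  by (simp add: scale_def const_mult mult.assoc)

lemma scale_1 [simp]: "1 *\<^sub>s p = p"
  by (simp add: scale_def)

lemma scale_diff_right: "c *\<^sub>s (p - r) = c *\<^sub>s p - c *\<^sub>s r"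
  by (simp add: scale_def right_diff_distrib)

lemma scale_minus_right: "c *\<^sub>s (- p) = - (c *\<^sub>s p)"
  by (simp add: scale_def)

lemma scale_minus_left: "(- c) *\<^sub>s p = - (c *\<^sub>s p)"
  by (simp add: scale_def const_def single_uminus)

section \<open>Substitution\<close>

fun subst_word :: "('g \<Rightarrow> ('h, 'a::field) free_algebra) \<Rightarrow> 'g free_monoid \<Rightarrow> ('h, 'a) free_algebra"
  where "subst_word \<sigma> (Word gs) = prod_list (map \<sigma> gs)"

text \<open>The homomorphism that the universal property of the free algebra assigns to
  \<open>\<sigma>\<close>.\<close>

definition subst :: "('g \<Rightarrow> ('h, 'a::field) free_algebra) \<Rightarrow> ('g, 'a) free_algebra
    \<Rightarrow> ('h, 'a) free_algebra"
  where "subst \<sigma> p =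
    (\<Sum>w\<in>Poly_Mapping.keys p. const (Poly_Mapping.lookup p w) * subst_word \<sigma> w)"

lemma subst_word_add: "subst_word \<sigma> (u + v) = subst_word \<sigma> u * subst_word \<sigma> v"
  by (cases u; cases v) simp

text \<open>Words outside the support contribute zero, so sums for different elements can share one
  finite index set, as additivity requires.\<close>

lemma subst_superset:
  assumes "finite S" "Poly_Mapping.keys p \<subseteq> S"
  shows "subst \<sigma> p = (\<Sum>w\<in>S. const (Poly_Mapping.lookup p w) * subst_word \<sigma> w)"
  unfolding subst_def using assms by (intro sum.mono_neutral_left) (auto simp: in_keys_iff)

lemma subst_single: "subst \<sigma> (Poly_Mapping.single w c) = const c * subst_word \<sigma> w"
  by (subst subst_superset[of "{w}"]) auto

lemma subst_add: "subst \<sigma> (p + r) = subst \<sigma> p + subst \<sigma> r"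
proof -
  let ?S = "Poly_Mapping.keys p \<union> Poly_Mapping.keys r"
  have "Poly_Mapping.keys (p + r) \<subseteq> ?S"
    by (rule keys_add)
  then show ?thesis
    by (simp add: subst_superset[of ?S] lookup_add const_add distrib_right sum.distrib)
qed

lemma subst_diff: "subst \<sigma> (p - r) = subst \<sigma> p - subst \<sigma> r"
  by (metis subst_add eq_diff_eq)

text \<open>Biadditivity reduces the claim to two monomials, where the second coefficient moves past
  the image of the first word because constants are central.\<close>

lemma subst_mult: "subst \<sigma> (p * r) = subst \<sigma> p * subst \<sigma> r"
proof (induction p rule: single_induct)
  case (single u c)
  show ?case
  proof (induction r rule: single_induct)
    case (single v d)
    show ?case
      by (simp add: mult_single subst_single subst_word_add const_mult)
        (metis mult.assoc const_commute)
  qed (simp add: distrib_left subst_add)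
qed (simp add: distrib_right subst_add)

lemma subst_const [simp]: "subst \<sigma> (const c) = const c"
  unfolding const_def[of c] subst_single by (simp add: const_def zero_free_monoid_def)

lemma subst_1 [simp]: "subst \<sigma> 1 = 1"
  using subst_const[of \<sigma> 1] by simp

lemma subst_gvar [simp]: "subst \<sigma> (gvar g) = \<sigma> g"
  by (simp add: gvar_def subst_single)

lemma subst_scale: "subst \<sigma> (c *\<^sub>s p) = c *\<^sub>s subst \<sigma> p"
  by (simp add: scale_def subst_mult)

section \<open>Homomorphisms between presented algebras\<close>

lemma carrier_ring_of_type_algebra [simp]: "carrier ring_of_type_algebra = UNIV"
  by (simp add: ring_of_type_algebra_def)

text \<open>The record's negation is an inverse given by a definite description, so the difference
  is identified by the equation it satisfies rather than by unfolding.\<close>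

lemma minus_ring_of_type_algebra: "a \<ominus>\<^bsub>ring_of_type_algebra\<^esub> b = a - (b :: 'b::ring_1)"
proof -
  interpret ring "ring_of_type_algebra :: 'b ring"
    by (rule ring_ring_of_type_algebra)
  have "(a \<ominus>\<^bsub>ring_of_type_algebra\<^esub> b) \<oplus>\<^bsub>ring_of_type_algebra\<^esub> b = a"
    by (metis UNIV_I a_assoc l_neg minus_eq partial_object.select_convs(1) a_inv_closed r_zero
        ring_of_type_algebra_def)
  then show ?thesis
    by (simp add: ring_of_type_algebra_def eq_diff_eq)
qed

lemma cls_eq_iff: "cls rels p = cls rels r \<longleftrightarrow> p - r \<in> rel_ideal rels"
  using ring.quotient_eq_iff_same_a_r_cos[OF ring_ring_of_type_algebra ideal_rel_ideal, of p r rels]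
  by (simp add: cls_def minus_ring_of_type_algebra)

lemma cls_rel: "(l, r) \<in> rels \<Longrightarrow> cls rels l = cls rels r"
  unfolding cls_eq_iff rel_ideal_def
  by (rule subsetD[OF ring.genideal_self[OF ring_ring_of_type_algebra]])
    auto

text \<open>Products of classes are computed on representatives. This rule and its companions for
  the other operations allow rewriting modulo the relations inside a term.\<close>

lemma cls_mult_cong:
  "cls rels p = cls rels p' \<Longrightarrow> cls rels r = cls rels r' \<Longrightarrow> cls rels (p * r) = cls rels (p' * r')"
  by (metis presented_algebra_mult)

lemma cls_scale_cong: "cls rels p = cls rels p' \<Longrightarrow> cls rels (c *\<^sub>s p) = cls rels (c *\<^sub>s p')"
  by (metis presented_algebra_smult)

lemma cls_add_cong:
  "cls rels p = cls rels p' \<Longrightarrow> cls rels r = cls rels r' \<Longrightarrow> cls rels (p + r) = cls rels (p' + r')"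
  by (metis presented_algebra_add)

lemma cls_diff_cong:
  assumes "cls rels p = cls rels p'" "cls rels r = cls rels r'"
  shows "cls rels (p - r) = cls rels (p' - r')"
proof -
  \<comment> \<open>A difference is a sum with a \<open>-1\<close> multiple, so the two previous
    congruences suffice.\<close>
  have "cls rels (p + (-1) *\<^sub>s r) = cls rels (p' + (-1) *\<^sub>s r')"
    by (intro cls_add_cong cls_scale_cong assms)
  then show ?thesis by (simp add: scale_minus_left)
qed

lemmas cls_cong = cls_mult_cong cls_scale_cong cls_add_cong cls_diff_cong

definition preserves_rels :: "(('g, 'a::field) free_algebra \<times> ('g, 'a) free_algebra) set
    \<Rightarrow> (('h, 'a) free_algebra \<times> ('h, 'a) free_algebra) set
    \<Rightarrow> ('g \<Rightarrow> ('h, 'a) free_algebra) \<Rightarrow> bool"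
  where "preserves_rels rels rels' \<sigma> \<longleftrightarrow>
    (\<forall>(l, r) \<in> rels. cls rels' (subst \<sigma> l) = cls rels' (subst \<sigma> r))"

text \<open>The preimage of \<open>rel_ideal rels'\<close> under \<open>subst \<sigma>\<close> is an
  ideal containing the generators of \<open>rel_ideal rels\<close>, hence all of it.\<close>

lemma preserves_rels_cls_eq:
  assumes "preserves_rels rels rels' \<sigma>" and "cls rels p = cls rels r"
  shows "cls rels' (subst \<sigma> p) = cls rels' (subst \<sigma> r)"
proof -
  have hom: "ring_hom_ring ring_of_type_algebra ring_of_type_algebra (subst \<sigma>)"
    by (rule ring_hom_ringI[OF ring_ring_of_type_algebra ring_ring_of_type_algebra])
      (simp_all add: ring_of_type_algebra_def subst_add subst_mult)
  have "rel_ideal rels \<subseteq> {p \<in> carrier ring_of_type_algebra. subst \<sigma> p \<in> rel_ideal rels'}"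
    unfolding rel_ideal_def[of rels]
  proof (rule ring.genideal_minimal[OF ring_ring_of_type_algebra])
    show "ideal {p \<in> carrier ring_of_type_algebra. subst \<sigma> p \<in> rel_ideal rels'} ring_of_type_algebra"
      by (rule ring_hom_ring.ideal_vimage[OF hom ideal_rel_ideal])
    show "{l - r |l r. (l, r) \<in> rels}
        \<subseteq> {p \<in> carrier ring_of_type_algebra. subst \<sigma> p \<in> rel_ideal rels'}"
      using assms(1) by (fastforce simp: preserves_rels_def cls_eq_iff subst_diff)
  qed
  then show ?thesis using assms(2) by (auto simp: cls_eq_iff subst_diff)
qed

text \<open>A representative is chosen arbitrarily; the value is independent of the choice once
  \<open>\<sigma>\<close> preserves the relations, which is what \<open>induced_cls\<close> rests
  on.\<close>

definition induced :: "(('g, 'a::field) free_algebra \<times> ('g, 'a) free_algebra) set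
    \<Rightarrow> (('h, 'a) free_algebra \<times> ('h, 'a) free_algebra) set
    \<Rightarrow> ('g \<Rightarrow> ('h, 'a) free_algebra) \<Rightarrow> ('g, 'a) free_algebra set \<Rightarrow> ('h, 'a) free_algebra set"
  where "induced rels rels' \<sigma> A = cls rels' (subst \<sigma> (SOME p. cls rels p = A))"

lemma induced_cls:
  assumes "preserves_rels rels rels' \<sigma>"
  shows "induced rels rels' \<sigma> (cls rels p) = cls rels' (subst \<sigma> p)"
  unfolding induced_def
  by (rule preserves_rels_cls_eq[OF assms]) (rule someI, rule refl)

text \<open>The composite of the two substitutions respects sums and products and fixes constants,
  so agreement with the identity on generators modulo \<open>rels\<close> spreads to all
  elements.\<close>

lemma induced_inverse:
  assumes \<sigma>: "preserves_rels rels rels' \<sigma>" and \<tau>: "preserves_rels rels' rels \<tau>"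
    and gen: "\<And>g. cls rels (subst \<tau> (\<sigma> g)) = cls rels (gvar g)"
    and A: "A \<in> carrier (presented_algebra rels)"
  shows "induced rels' rels \<tau> (induced rels rels' \<sigma> A) = A"
proof -
  have "cls rels (subst \<tau> (subst \<sigma> p)) = cls rels p" for p
    by (induction p rule: free_algebra_induct)
      (simp_all only: subst_const subst_gvar gen subst_add subst_mult,
        (intro cls_add_cong cls_mult_cong; assumption)+)
  then show ?thesis
    using A by (auto simp: presented_algebra_carrier induced_cls[OF \<sigma>] induced_cls[OF \<tau>])
qed

lemma induced_alg_iso:
  assumes \<sigma>: "preserves_rels rels rels' \<sigma>" and \<tau>: "preserves_rels rels' rels \<tau>"
    and \<tau>\<sigma>: "\<And>g. cls rels (subst \<tau> (\<sigma> g)) = cls rels (gvar g)"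
    and \<sigma>\<tau>: "\<And>g. cls rels' (subst \<sigma> (\<tau> g)) = cls rels' (gvar g)"
  shows "induced rels rels' \<sigma> \<in> alg_iso (presented_algebra rels) (presented_algebra rels')"
proof -
  have "bij_betw (induced rels rels' \<sigma>) (carrier (presented_algebra rels))
      (carrier (presented_algebra rels'))"
    using induced_inverse[OF \<sigma> \<tau> \<tau>\<sigma>] induced_inverse[OF \<tau> \<sigma> \<sigma>\<tau>]
    by (intro bij_betw_byWitness[where f' = "induced rels' rels \<tau>"])
      (auto simp: presented_algebra_carrier induced_cls[OF \<sigma>] induced_cls[OF \<tau>])
  then show ?thesis
    by (auto simp: alg_iso_def ring_iso_def ring_hom_def presented_algebra_carrier
        presented_algebra_mult presented_algebra_add presented_algebra_one presented_algebra_smult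
        induced_cls[OF \<sigma>] subst_add subst_mult subst_scale)
qed

section \<open>Commutation rules from conjugation relations\<close>

lemma cls_mult_commute:
  assumes "cls rels (y * x * y') = cls rels (c *\<^sub>s x)" "cls rels (y' * y) = cls rels 1"
  shows "cls rels (y * x) = cls rels (c *\<^sub>s (x * y))"
proof -
  have "cls rels (y * x) = cls rels (y * x * (y' * y))"
    using cls_mult_cong[OF refl assms(2), of "y * x"] by simp
  also have "\<dots> = cls rels (c *\<^sub>s (x * y))"
    using cls_mult_cong[OF assms(1) refl, of y] by (simp add: mult.assoc)
  finally show ?thesis .
qed

text \<open>Multiplying the conjugation relation by \<open>y'\<close> on the left cancels
  \<open>y\<close>.\<close>

lemma cls_mult_inverse_commute:
  assumes "cls rels (y * x * y') = cls rels (c *\<^sub>s x)" "cls rels (y' * y) = cls rels 1"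
  shows "cls rels (x * y') = cls rels (c *\<^sub>s (y' * x))"
proof -
  have "cls rels (x * y') = cls rels (y' * y * (x * y'))"
    using cls_mult_cong[OF assms(2) refl, of "x * y'"] by simp
  also have "\<dots> = cls rels (c *\<^sub>s (y' * x))"
    using cls_mult_cong[OF refl assms(1), of y'] by (simp add: mult.assoc)
  finally show ?thesis .
qed

section \<open>The generators \<open>\<nu>\<^sub>x\<close>, \<open>y\<close>, \<open>\<nu>\<^sub>z\<close>\<close>

text \<open>The images are the closed forms in \<open>e\<close>, \<open>f\<close>, \<open>k\<close>,
  not the equitable expressions of \<open>nu_elem\<close>; \<open>cls_nu_to_chev\<close> shows that
  the classes agree.\<close>

fun nu_to_chev :: "'a::field \<Rightarrow> nu_gen \<Rightarrow> (chev_gen, 'a) free_algebra"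
  where
    "nu_to_chev q NuX = (- q * (q - inverse q)) *\<^sub>s (gvar K * gvar F)"
  | "nu_to_chev q Y = gvar K"
  | "nu_to_chev q Yinv = gvar Kinv"
  | "nu_to_chev q NuZ = (q - inverse q) *\<^sub>s gvar E"

fun chev_to_nu :: "'a::field \<Rightarrow> chev_gen \<Rightarrow> (nu_gen, 'a) free_algebra"
  where
    "chev_to_nu q E = inverse (q - inverse q) *\<^sub>s gvar NuZ"
  | "chev_to_nu q K = gvar Y"
  | "chev_to_nu q Kinv = gvar Yinv"
  | "chev_to_nu q F = (- inverse q * inverse (q - inverse q)) *\<^sub>s (gvar Yinv * gvar NuX)"

lemma chev_cls:
  "cls (chev_rels q) (gvar K * gvar Kinv) = cls (chev_rels q) 1"
  "cls (chev_rels q) (gvar Kinv * gvar K) = cls (chev_rels q) 1"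
  "cls (chev_rels q) (gvar K * gvar E * gvar Kinv) = cls (chev_rels q) (q\<^sup>2 *\<^sub>s gvar E)"
  "cls (chev_rels q) (gvar K * gvar F * gvar Kinv) = cls (chev_rels q) (inverse (q\<^sup>2) *\<^sub>s gvar F)"
  "cls (chev_rels q) (gvar E * gvar F - gvar F * gvar E)
    = cls (chev_rels q) (inverse (q - inverse q) *\<^sub>s (gvar K - gvar Kinv))"
  by (rule cls_rel, simp only: chev_rels_def Let_def, blast)+

lemma nu_cls:
  "cls (nu_rels q) (gvar Y * gvar Yinv) = cls (nu_rels q) 1"
  "cls (nu_rels q) (gvar Yinv * gvar Y) = cls (nu_rels q) 1"
  "cls (nu_rels q) (gvar Y * gvar NuX * gvar Yinv) = cls (nu_rels q) (inverse (q\<^sup>2) *\<^sub>s gvar NuX)"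
  "cls (nu_rels q) (gvar Y * gvar NuZ * gvar Yinv) = cls (nu_rels q) (q\<^sup>2 *\<^sub>s gvar NuZ)"
  "cls (nu_rels q) (inverse (q - inverse q) *\<^sub>s
      (q *\<^sub>s (gvar NuZ * gvar NuX) - inverse q *\<^sub>s (gvar NuX * gvar NuZ)))
    = cls (nu_rels q) (1 - (gvar Y)\<^sup>2)"
  by (rule cls_rel, simp only: nu_rels_def Let_def, blast)+

text \<open>If the difference vanished, then q^2 = 1 and so q^4 = 1. This justifies dividing by
  \<open>q - inverse q\<close>.\<close>

lemma q_minus_inverse_neq_0:
  assumes "(q::'a::field) \<noteq> 0" "q ^ 4 \<noteq> 1"
  shows "q - inverse q \<noteq> 0"
proof
  assume "q - inverse q = 0"
  then have "q * q = 1" using assms(1) by (metis eq_iff_diff_eq_0 right_inverse)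
  then have "q ^ 4 = 1" by (simp add: power4_eq_xxxx)
  with assms(2) show False by simp
qed

text \<open>The conjugation relation gives ke = q^2 ek, which is solved here for ek.\<close>

lemma chev_EK:
  assumes "(q::'a::field) \<noteq> 0"
  shows "cls (chev_rels q) (gvar E * gvar K) = cls (chev_rels q) (inverse (q\<^sup>2) *\<^sub>s (gvar K * gvar E))"
  using cls_scale_cong[OF cls_mult_commute[OF chev_cls(3)[of q] chev_cls(2)],
      where c = "inverse (q\<^sup>2)"] assms
  by simp

text \<open>This evaluates the term k^(-1)ek that arises in the product xy in the definition of
  \<open>\<nu>\<^sub>z\<close>.\<close>

lemma chev_Kinv_EK:
  assumes "(q::'a::field) \<noteq> 0"
  shows "cls (chev_rels q) (gvar Kinv * gvar E * gvar K) = cls (chev_rels q) (inverse (q\<^sup>2) *\<^sub>s gvar E)"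
proof -
  have "cls (chev_rels q) (gvar Kinv * gvar E * gvar K)
      = cls (chev_rels q) (inverse (q\<^sup>2) *\<^sub>s (gvar Kinv * gvar K * gvar E))"
    using cls_mult_cong[OF refl chev_EK[OF assms], of "gvar Kinv"] by (simp add: mult.assoc)
  also have "\<dots> = cls (chev_rels q) (inverse (q\<^sup>2) *\<^sub>s (1 * gvar E))"
    by (intro cls_scale_cong cls_mult_cong chev_cls refl)
  finally show ?thesis by simp
qed

section \<open>Compatibility of the substitutions with the relations\<close>

lemma preserves_rels_nu_to_chev:
  assumes "(q::'a::field) \<noteq> 0" "q ^ 4 \<noteq> 1"
  shows "preserves_rels (nu_rels q) (chev_rels q) (nu_to_chev q)"
proof -
  define c where "c = q - inverse q"
  have c: "c \<noteq> 0" using q_minus_inverse_neq_0[OF assms] by (simp add: c_def)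
  define C where "C = cls (chev_rels q)"
  note rel = chev_cls[of q, folded C_def c_def]
  note cong = cls_cong[of "chev_rels q", folded C_def]
  define e f k k' :: "(chev_gen, 'a) free_algebra"
    where "e = gvar E" and "f = gvar F" and "k = gvar K" and "k' = gvar Kinv"
  note gens = e_def[symmetric] f_def[symmetric] k_def[symmetric] k'_def[symmetric]
  note rel = rel[unfolded gens]
  \<comment> \<open>Regrouped as \<open>k * (k * f * k')\<close>, this is the conjugation relation
    for \<open>f\<close> with an extra factor \<open>k\<close> on the left.\<close>
  have x: "C (k * (d *\<^sub>s (k * f)) * k') = C (inverse (q\<^sup>2) *\<^sub>s d *\<^sub>s (k * f))" for d
    using cong(2)[OF cong(1)[OF refl rel(4)], of d k] by (simp add: mult.assoc mult.commute)
  have z: "C (k * (d *\<^sub>s e) * k') = C (q\<^sup>2 *\<^sub>s d *\<^sub>s e)" for d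
    using cong(2)[OF rel(3), of d] by (simp add: mult.commute)
  have xz: "C (inverse c *\<^sub>s (q *\<^sub>s (c *\<^sub>s e * (- q * c) *\<^sub>s (k * f))
      - inverse q *\<^sub>s ((- q * c) *\<^sub>s (k * f) * c *\<^sub>s e))) = C (1 - k\<^sup>2)"
  proof -
    have "inverse c *\<^sub>s (q *\<^sub>s (c *\<^sub>s e * (- q * c) *\<^sub>s (k * f))
      - inverse q *\<^sub>s ((- q * c) *\<^sub>s (k * f) * c *\<^sub>s e))
      = (- q * c) *\<^sub>s (q *\<^sub>s (e * k * f) - inverse q *\<^sub>s (k * f * e))"
      using c assms(1) by (simp add: scale_diff_right mult.assoc) (simp add: field_simps)
    \<comment> \<open>Since q * q^(-2) = q^(-1), exchanging \<open>e\<close> and \<open>k\<close>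
      gives both terms the same coefficient up to sign, and the ordinary commutator of
      \<open>e\<close> and \<open>f\<close> factors out.\<close>
    also have "C \<dots> = C ((- q * c) *\<^sub>s (q *\<^sub>s (inverse (q\<^sup>2) *\<^sub>s (k * e) * f)
        - inverse q *\<^sub>s (k * f * e)))"
      by (intro cong refl chev_EK[OF assms(1), folded C_def, unfolded gens])
    also have "(- q * c) *\<^sub>s (q *\<^sub>s (inverse (q\<^sup>2) *\<^sub>s (k * e) * f) - inverse q *\<^sub>s (k * f * e))
        = (- c) *\<^sub>s (k * (e * f - f * e))"
      using assms(1) by (simp add: scale_diff_right right_diff_distrib mult.assoc power2_eq_square)
        (simp add: field_simps)
    also have "C \<dots> = C ((- c) *\<^sub>s (k * (inverse c *\<^sub>s (k - k'))))"
      by (intro cong refl rel)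
    also have "(- c) *\<^sub>s (k * (inverse c *\<^sub>s (k - k'))) = k * k' - k * k"
      using c by (simp add: scale_minus_left right_diff_distrib)
    also have "C \<dots> = C (1 - k * k)"
      by (intro cong refl rel)
    finally show ?thesis by (simp add: power2_eq_square)
  qed
  show ?thesis
    using rel x z xz
    by (simp add: preserves_rels_def nu_rels_def Let_def subst_mult subst_scale subst_diff power2_eq_square
        gens C_def[symmetric] c_def[symmetric])
qed

lemma preserves_rels_chev_to_nu:
  assumes "(q::'a::field) \<noteq> 0" "q ^ 4 \<noteq> 1"
  shows "preserves_rels (chev_rels q) (nu_rels q) (chev_to_nu q)"
proof -
  define c where "c = q - inverse q"
  have c: "c \<noteq> 0" using q_minus_inverse_neq_0[OF assms] by (simp add: c_def)
  define C where "C = cls (nu_rels q)"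
  define nx y y' nz :: "(nu_gen, 'a) free_algebra"
    where "nx = gvar NuX" and "y = gvar Y" and "y' = gvar Yinv" and "nz = gvar NuZ"
  note gens = nx_def[symmetric] y_def[symmetric] y'_def[symmetric] nz_def[symmetric]
  note rel = nu_cls[of q, folded C_def c_def, unfolded gens]
  note cong = cls_cong[of "nu_rels q", folded C_def]
  note commute = cls_mult_inverse_commute[of "nu_rels q", folded C_def]
  \<comment> \<open>This is the scalar in the image of \<open>F\<close>; it satisfies q * d =
    -1/c.\<close>
  define d where "d = - inverse q * inverse c"
  have e: "C (y * (inverse c *\<^sub>s nz) * y') = C (q\<^sup>2 *\<^sub>s inverse c *\<^sub>s nz)"
    using cong(2)[OF rel(4), of "inverse c"] by (simp add: mult.commute)
  have f: "C (y * (d *\<^sub>s (y' * nx)) * y') = C (inverse (q\<^sup>2) *\<^sub>s d *\<^sub>s (y' * nx))"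
  proof -
    have "C (y * (d *\<^sub>s (y' * nx)) * y') = C (d *\<^sub>s (y * y' * (nx * y')))"
      by (simp add: mult.assoc)
    also have "\<dots> = C (d *\<^sub>s (1 * (inverse (q\<^sup>2) *\<^sub>s (y' * nx))))"
      by (intro cong rel commute[OF rel(3) rel(2)])
    finally show ?thesis by (simp add: mult.commute)
  qed
  have ef: "C (inverse c *\<^sub>s nz * d *\<^sub>s (y' * nx) - d *\<^sub>s (y' * nx) * inverse c *\<^sub>s nz)
      = C (inverse c *\<^sub>s (y - y'))"
  proof -
    have "C (inverse c *\<^sub>s nz * d *\<^sub>s (y' * nx) - d *\<^sub>s (y' * nx) * inverse c *\<^sub>s nz)
        = C ((d * inverse c) *\<^sub>s (nz * y' * nx - y' * nx * nz))"
      by (simp add: scale_diff_right mult.assoc mult.commute)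
    \<comment> \<open>Moving \<open>y'\<close> to the front of the first term costs q^2. Taking out
      one factor q leaves the q-commutator with coefficients q and q^(-1), and that factor cancels
      the q^(-1) in \<open>d\<close>.\<close>
    also have "\<dots> = C ((d * inverse c) *\<^sub>s ((q\<^sup>2 *\<^sub>s (y' * nz)) * nx - y' * nx * nz))"
      by (intro cong refl commute[OF rel(4) rel(2)])
    also have "(d * inverse c) *\<^sub>s ((q\<^sup>2 *\<^sub>s (y' * nz)) * nx - y' * nx * nz)
        = (- inverse c) *\<^sub>s (y' * (inverse c *\<^sub>s (q *\<^sub>s (nz * nx) - inverse q *\<^sub>s (nx * nz))))"
      using assms(1)
      by (simp add: scale_diff_right right_diff_distrib mult.assoc d_def power2_eq_square)
        (simp add: field_simps)
    also have "C \<dots> = C ((- inverse c) *\<^sub>s (y' * (1 - y\<^sup>2)))"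
      by (intro cong refl rel)
    also have "(- inverse c) *\<^sub>s (y' * (1 - y\<^sup>2)) = inverse c *\<^sub>s (y' * y * y - y')"
      by (simp add: scale_minus_left scale_diff_right right_diff_distrib power2_eq_square mult.assoc)
    also have "C \<dots> = C (inverse c *\<^sub>s (1 * y - y'))"
      by (intro cong refl rel)
    finally show ?thesis by simp
  qed
  \<comment> \<open>The scalar-collecting rules are switched off so that the goals keep the shape in
    which \<open>e\<close>, \<open>f\<close> and \<open>ef\<close> are stated.\<close>
  show ?thesis
    using rel e f[unfolded d_def] ef[unfolded d_def]
    by (simp add: preserves_rels_def chev_rels_def Let_def subst_mult subst_scale subst_diff
        gens C_def[symmetric] c_def[symmetric]
        del: scale_mult_left scale_mult_right scale_scale)
qed

section \<open>Round trips on generators and the equitable form\<close>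

text \<open>Only \<open>F\<close> calls on a relation, k^(-1)k = 1; for the other generators the
  scalars already cancel in the free algebra.\<close>

lemma chev_to_nu_to_chev:
  assumes "(q::'a::field) \<noteq> 0" "q ^ 4 \<noteq> 1"
  shows "cls (chev_rels q) (subst (nu_to_chev q) (chev_to_nu q g)) = cls (chev_rels q) (gvar g)"
proof (cases g)
  case F
  have "cls (chev_rels q) (gvar Kinv * gvar K * gvar F) = cls (chev_rels q) (1 * gvar F)"
    by (intro cls_mult_cong chev_cls refl)
  with F show ?thesis
    using assms(1) q_minus_inverse_neq_0[OF assms]
    by (simp add: subst_scale subst_mult mult.assoc[symmetric] del: mult_minus_left)
      (simp add: mult_ac)
qed (use q_minus_inverse_neq_0[OF assms] in \<open>simp_all add: subst_scale\<close>)

text \<open>Here \<open>NuX\<close> is the one generator that calls on a relation, namely that y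
  times its inverse is 1.\<close>

lemma nu_to_chev_to_nu:
  assumes "(q::'a::field) \<noteq> 0" "q ^ 4 \<noteq> 1"
  shows "cls (nu_rels q) (subst (chev_to_nu q) (nu_to_chev q g)) = cls (nu_rels q) (gvar g)"
proof (cases g)
  case NuX
  have "cls (nu_rels q) (gvar Y * gvar Yinv * gvar NuX) = cls (nu_rels q) (1 * gvar NuX)"
    by (intro cls_mult_cong nu_cls refl)
  with NuX show ?thesis
    using assms(1) q_minus_inverse_neq_0[OF assms]
    by (simp add: subst_scale subst_mult mult.assoc[symmetric])
      (simp add: mult_ac)
qed (use q_minus_inverse_neq_0[OF assms] in \<open>simp_all add: subst_scale\<close>)

text \<open>Modulo the relations, yz = 1 + (q - q^(-1))kf and xy = 1 - q^(-1)(q - q^(-1))e, so the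
  constant 1 drops out of both definitions.\<close>

lemma cls_nu_to_chev:
  assumes "(q::'a::field) \<noteq> 0"
  shows "cls (chev_rels q) (nu_to_chev q g) = nu_elem q g"
proof (cases g)
  case NuX
  have "nu_elem q NuX = cls (chev_rels q)
      (q *\<^sub>s (1 - (gvar K * gvar Kinv + (q - inverse q) *\<^sub>s (gvar K * gvar F))))"
    by (simp add: equit_y_def equit_z_def distrib_left)
  also have "\<dots> = cls (chev_rels q) (q *\<^sub>s (1 - (1 + (q - inverse q) *\<^sub>s (gvar K * gvar F))))"
    by (intro cls_cong refl chev_cls)
  also have "\<dots> = cls (chev_rels q) (nu_to_chev q NuX)"
    by (simp add: scale_minus_left scale_minus_right)
  finally show ?thesis using NuX by simp
next
  case NuZ
  \<comment> \<open>One q comes from \<open>\<nu>\<^sub>z\<close>, one from \<open>equit_x\<close>,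
    and q^(-2) from moving \<open>k\<close> past \<open>e\<close>.\<close>
  have coeff: "q * (q * c * inverse (q\<^sup>2)) = c" for c
    using assms by (simp add: field_simps power2_eq_square)
  have "nu_elem q NuZ = cls (chev_rels q) (q *\<^sub>s (1 - (gvar Kinv * gvar K
      - (q * (q - inverse q)) *\<^sub>s (gvar Kinv * gvar E * gvar K))))"
    by (simp add: equit_y_def equit_x_def left_diff_distrib)
  also have "\<dots> = cls (chev_rels q) (q *\<^sub>s (1 - (1
      - (q * (q - inverse q)) *\<^sub>s (inverse (q\<^sup>2) *\<^sub>s gvar E))))"
    by (intro cls_cong refl chev_cls chev_Kinv_EK[OF assms])
  also have "\<dots> = cls (chev_rels q) (nu_to_chev q NuZ)"
    by (simp add: coeff)
  finally show ?thesis using NuZ by simp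
qed (simp_all add: equit_y_def)

theorem theorem6p2:
  fixes q :: "'a::field"
  assumes "q \<noteq> 0" and "q ^ 4 \<noteq> 1"
  shows "has_presentation (Uq q) (nu_elem q) (nu_rels q) \<and>
    (\<exists>\<phi> \<psi>.
      \<phi> \<in> alg_iso (presented_algebra (nu_rels q)) (Uq q) \<and>
      \<phi> (cls (nu_rels q) (gvar NuX)) = cls (chev_rels q) ((- q * (q - inverse q)) *\<^sub>s (gvar K * gvar F)) \<and>
      \<phi> (cls (nu_rels q) (gvar Y)) = cls (chev_rels q) (gvar K) \<and>
      \<phi> (cls (nu_rels q) (gvar Yinv)) = cls (chev_rels q) (gvar Kinv) \<and>
      \<phi> (cls (nu_rels q) (gvar NuZ)) = cls (chev_rels q) ((q - inverse q) *\<^sub>s gvar E) \<and>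
      \<psi> \<in> alg_iso (Uq q) (presented_algebra (nu_rels q)) \<and>
      (\<forall>a \<in> carrier (presented_algebra (nu_rels q)). \<psi> (\<phi> a) = a) \<and>
      (\<forall>b \<in> carrier (Uq q). \<phi> (\<psi> b) = b) \<and>
      \<psi> (cls (chev_rels q) (gvar E)) = cls (nu_rels q) (inverse (q - inverse q) *\<^sub>s gvar NuZ) \<and>
      \<psi> (cls (chev_rels q) (gvar K)) = cls (nu_rels q) (gvar Y) \<and>
      \<psi> (cls (chev_rels q) (gvar Kinv)) = cls (nu_rels q) (gvar Yinv) \<and>
      \<psi> (cls (chev_rels q) (gvar F)) =
        cls (nu_rels q) ((- inverse q * inverse (q - inverse q)) *\<^sub>s (gvar Yinv * gvar NuX)))"
proof -
  let ?\<phi> = "induced (nu_rels q) (chev_rels q) (nu_to_chev q)"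
  let ?\<psi> = "induced (chev_rels q) (nu_rels q) (chev_to_nu q)"
  note \<sigma> = preserves_rels_nu_to_chev[OF assms] and \<tau> = preserves_rels_chev_to_nu[OF assms]
  note inv = nu_to_chev_to_nu[OF assms] chev_to_nu_to_chev[OF assms]
  have \<phi>: "?\<phi> \<in> alg_iso (presented_algebra (nu_rels q)) (Uq q)"
    unfolding Uq_def by (rule induced_alg_iso[OF \<sigma> \<tau> inv])
  have \<psi>: "?\<psi> \<in> alg_iso (Uq q) (presented_algebra (nu_rels q))"
    unfolding Uq_def by (rule induced_alg_iso[OF \<tau> \<sigma> inv(2,1)])
  have \<psi>\<phi>: "\<forall>a \<in> carrier (presented_algebra (nu_rels q)). ?\<psi> (?\<phi> a) = a"
    using induced_inverse[OF \<sigma> \<tau> inv(1)] by blast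
  have \<phi>\<psi>: "\<forall>b \<in> carrier (Uq q). ?\<phi> (?\<psi> b) = b"
    unfolding Uq_def using induced_inverse[OF \<tau> \<sigma> inv(2)] by blast
  \<comment> \<open>With this, the map built from the closed forms also witnesses the presentation
    by the equitably defined elements.\<close>
  have gen: "?\<phi> (cls (nu_rels q) (gvar g)) = nu_elem q g" for g
    by (simp add: induced_cls[OF \<sigma>] cls_nu_to_chev[OF assms(1)])
  have "has_presentation (Uq q) (nu_elem q) (nu_rels q)"
    unfolding has_presentation_def using \<phi> gen by blast
  then show ?thesis
    using \<phi> \<psi> \<psi>\<phi> \<phi>\<psi>
    by (intro conjI exI[of _ ?\<phi>] exI[of _ ?\<psi>]) (simp_all add: induced_cls[OF \<sigma>] induced_cls[OF \<tau>])
qed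

end
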